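(* There is a locally finite highly arc-transitive digraph for which the reachability relation is universal. In fact, for every composite integer $d \ge 4$ there is a locally finite highly arc-transitive digraph with universal reachability relation in which all in-degrees and all out-degrees are equal to $d$.
   Context: A digraph $D$ consists of a vertex set $V(D)$ and an arc set $E(D)\subseteq V(D)\times V(D)$; digraphs have no loops and may be infinite. An arc $(u,v)$ is written $uv$. For $s\ge 0$, an $s$-arc in $D$ is an $(s+1)$-tuple $(v_0,\dots,v_s)$ of vertices such that $v_{i-1}v_i\in E(D)$ for each $i=1,\dots,s$. $D$ is $s$-arc transitive if $D$ has no isolated vertices, every arc of $D$ lies on some $s$-arc (for $s\ge1$), and for any two $s$-arcs $(v_i)_{i=0}^s$, $(v_i')_{i=0}^s$ there is an automorphism $f$ of $D$ with $f(v_i)=v_i'$ for all $i$. $D$ is highly arc-transitive if it is $s$-arc transitive for every $s\ge 0$. $D$ is locally finite if every vertex has finite in-degree and finite out-degree. An alternating walk in $D$ is a sequence $(v_0,v_1,\dots,v_s)$ of vertices such that, either for all even $i$ or for all odd $i$, $v_iv_{i+1}$ and $v_iv_{i-1}$ are arcs of $D$ (whenever the indices lie in $\{0,\dots,s\}$); i.e. consecutive arcs are traversed alternately forward and backward. For arcs $e,e'$ of $D$, write $e\sim e'$ ($e'$ is reachable from $e$) if there is an alternating walk whose first arc is $e$ and whose last arc is $e'$. This is an equivalence relation on $E(D)$, called the reachability relation; it is universal if it has exactly one equivalence class. *)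

theory Defs
  imports "Graph_Theory.Graph_Theory" "HOL-Computational_Algebra.Primes"
begin

text \<open>
  Digraphs without parallel arcs are rendered by the record \<open>pair_pre_digraph\<close> of the library;
  \<open>pair_loopfree_digraph D\<close> says that the arcs of \<open>D\<close> are pairs of vertices of \<open>D\<close> and that there
  are no loops. Neither condition restricts \<open>D\<close> to be finite.
\<close>

definition locally_finite_digraph :: "'a pair_pre_digraph \<Rightarrow> bool" where
  "locally_finite_digraph D \<longleftrightarrow>
     (\<forall>v\<in>pverts D. finite (in_arcs D v) \<and> finite (out_arcs D v))"

definition no_isolated_vertices :: "'a pair_pre_digraph \<Rightarrow> bool" where
  "no_isolated_vertices D \<longleftrightarrow>
     (\<forall>v\<in>pverts D. \<exists>w. (v, w) \<in> parcs D \<or> (w, v) \<in> parcs D)"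

definition s_arc :: "'a pair_pre_digraph \<Rightarrow> nat \<Rightarrow> 'a list \<Rightarrow> bool" where
  "s_arc D s p \<longleftrightarrow>
     length p = s + 1 \<and> set p \<subseteq> pverts D \<and> (\<forall>i<s. (p ! i, p ! (i + 1)) \<in> parcs D)"

definition digraph_automorphism :: "'a pair_pre_digraph \<Rightarrow> ('a \<Rightarrow> 'a) \<Rightarrow> bool" where
  "digraph_automorphism D f \<longleftrightarrow>
     bij_betw f (pverts D) (pverts D) \<and>
     (\<forall>u\<in>pverts D. \<forall>v\<in>pverts D. (f u, f v) \<in> parcs D \<longleftrightarrow> (u, v) \<in> parcs D)"

definition s_arc_transitive :: "'a pair_pre_digraph \<Rightarrow> nat \<Rightarrow> bool" where
  "s_arc_transitive D s \<longleftrightarrow>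
     no_isolated_vertices D \<and>
     (s \<ge> 1 \<longrightarrow> (\<forall>(u, v)\<in>parcs D. \<exists>p. s_arc D s p \<and> (\<exists>i<s. p ! i = u \<and> p ! (i + 1) = v))) \<and>
     (\<forall>p q. s_arc D s p \<and> s_arc D s q \<longrightarrow>
        (\<exists>f. digraph_automorphism D f \<and> (\<forall>i\<le>s. f (p ! i) = q ! i)))"

definition highly_arc_transitive :: "'a pair_pre_digraph \<Rightarrow> bool" where
  "highly_arc_transitive D \<longleftrightarrow> (\<forall>s. s_arc_transitive D s)"

text \<open>
  The Boolean \<open>b\<close> selects the parity of the positions from which arcs emanate: the even ones if
  \<open>b\<close> holds, the odd ones otherwise. It is kept as a parameter because in the presence of two
  opposite arcs \<open>uv\<close> and \<open>vu\<close> the vertex sequence alone does not determine which of them is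
  traversed.
\<close>
definition alternating_walk :: "'a pair_pre_digraph \<Rightarrow> bool \<Rightarrow> 'a list \<Rightarrow> bool" where
  "alternating_walk D b p \<longleftrightarrow>
     p \<noteq> [] \<and> set p \<subseteq> pverts D \<and>
     (\<forall>i<length p. (even i \<longleftrightarrow> b) \<longrightarrow>
        (i + 1 < length p \<longrightarrow> (p ! i, p ! (i + 1)) \<in> parcs D) \<and>
        (0 < i \<longrightarrow> (p ! i, p ! (i - 1)) \<in> parcs D))"

text \<open>The arc traversed between positions \<open>i\<close> and \<open>i + 1\<close>.\<close>
definition walk_arc :: "bool \<Rightarrow> 'a list \<Rightarrow> nat \<Rightarrow> 'a \<times> 'a" where
  "walk_arc b p i = (if even i \<longleftrightarrow> b then (p ! i, p ! (i + 1)) else (p ! (i + 1), p ! i))"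

text \<open>
  A list of length \<open>n \<ge> 2\<close> traverses \<open>n - 1\<close> arcs, the last one starting at position \<open>n - 2\<close>.
\<close>
definition reachability_relation :: "'a pair_pre_digraph \<Rightarrow> ('a \<times> 'a) rel" where
  "reachability_relation D =
     {(e, e'). \<exists>b p. alternating_walk D b p \<and> length p \<ge> 2 \<and>
        walk_arc b p 0 = e \<and> walk_arc b p (length p - 2) = e'}"

definition universal_reachability :: "'a pair_pre_digraph \<Rightarrow> bool" where
  "universal_reachability D \<longleftrightarrow> (\<exists>!C. C \<in> parcs D // reachability_relation D)"

end

theory Submission
  imports Defs "HOL-Library.Countable" "HOL-Combinatorics.Transposition"
begin

text \<open>
  Write \<open>d = a b\<close> with \<open>a, b \<ge> 2\<close> and let \<open>T\<close> be the infinite tree with bipartition classes \<open>X\<close>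
  and \<open>Y\<close> in which vertices of \<open>Y\<close> have valency \<open>a + 1\<close> and vertices of \<open>X\<close> have valency
  \<open>b + 1\<close>. The vertices of the digraph \<open>D\<close> are the edges of \<open>T\<close>, each directed from \<open>X\<close> to
  \<open>Y\<close>; there is an arc from \<open>xy\<close> to \<open>zw\<close> whenever \<open>x, y, z, w\<close> is a path of length three in
  \<open>T\<close>. All in- and out-degrees of \<open>D\<close> are \<open>a b\<close>.

  An \<open>s\<close>-arc of \<open>D\<close> is nothing but a non-backtracking walk of length \<open>2 s + 1\<close> in \<open>T\<close> that
  starts in \<open>X\<close>. The group of automorphisms of \<open>T\<close> that preserve the bipartition acts on \<open>D\<close>, and
  it is transitive on such walks because all branches of \<open>T\<close> behind vertices of the same class look
  alike. Hence \<open>D\<close> is highly arc-transitive.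

  For the reachability relation it matters that an arc moves along \<open>T\<close> by two edges at once. Two
  edges that share an endpoint in \<open>Y\<close> have a common out-neighbour, found behind a third edge at that
  endpoint (\<open>common_out_neighbour_if_meets_True\<close>). Two edges \<open>xy\<close> and \<open>xy'\<close> that share an endpoint in \<open>X\<close> can be replaced, up to the
  previous case, by edges meeting them in \<open>y\<close> and in \<open>y'\<close>, and these have a third edge at \<open>x\<close> as
  a common out-neighbour (\<open>connected_if_meets_False\<close>). Since \<open>T\<close> is connected, alternating walks connect all arcs.

  The edges of \<open>T\<close> are represented by words that record the way from a root edge, as in the normal
  form for a free product of two groups of orders \<open>a + 1\<close> and \<open>b + 1\<close>. Two families of involutions
  then suffice as automorphisms: \<open>swap_root\<close> moves any edge step by step to the root edge
  (\<open>ex_automorphism_to_root\<close>), and \<open>twist\<close> carries one walk away from the root edge to any other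
  (\<open>ex_automorphism_rooted_s_arcs\<close>).
\<close>

section \<open>Isomorphisms of digraphs\<close>

definition digraph_iso_on :: "('a \<Rightarrow> 'b) \<Rightarrow> 'a pair_pre_digraph \<Rightarrow> 'b pair_pre_digraph \<Rightarrow> bool" where
  "digraph_iso_on f D E \<longleftrightarrow>
     bij_betw f (pverts D) (pverts E) \<and>
     (\<forall>u\<in>pverts D. \<forall>v\<in>pverts D. (f u, f v) \<in> parcs E \<longleftrightarrow> (u, v) \<in> parcs D)"

lemma digraph_automorphism_iff_iso: "digraph_automorphism D f \<longleftrightarrow> digraph_iso_on f D D"
  by (simp add: digraph_automorphism_def digraph_iso_on_def)

lemma digraph_iso_on_in_verts: "digraph_iso_on f D E \<Longrightarrow> v \<in> pverts D \<Longrightarrow> f v \<in> pverts E"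
  by (auto simp: digraph_iso_on_def bij_betw_def)

lemma digraph_iso_on_inv:
  assumes "digraph_iso_on f D E"
  shows "digraph_iso_on (inv_into (pverts D) f) E D"
proof -
  have b: "bij_betw f (pverts D) (pverts E)"
    using assms by (simp add: digraph_iso_on_def)
  have "(inv_into (pverts D) f u, inv_into (pverts D) f v) \<in> parcs D \<longleftrightarrow> (u, v) \<in> parcs E"
    if "u \<in> pverts E" "v \<in> pverts E" for u v
  proof -
    have "inv_into (pverts D) f w \<in> pverts D" "f (inv_into (pverts D) f w) = w"
      if "w \<in> pverts E" for w
      using b that by (auto simp: bij_betw_def inv_into_into f_inv_into_f)
    then show ?thesis
      using assms that unfolding digraph_iso_on_def by metis
  qed
  then show ?thesis
    using bij_betw_inv_into[OF b] by (simp add: digraph_iso_on_def)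
qed

lemma digraph_iso_on_inv_apply:
  assumes "digraph_iso_on f D E" "v \<in> pverts D"
  shows "inv_into (pverts D) f (f v) = v"
  using assms by (auto simp: digraph_iso_on_def bij_betw_def)

lemma digraph_iso_on_comp:
  assumes "digraph_iso_on f D E" "digraph_iso_on g E F"
  shows "digraph_iso_on (g \<circ> f) D F"
proof -
  have "f v \<in> pverts E" if "v \<in> pverts D" for v
    using assms(1) that by (rule digraph_iso_on_in_verts)
  then show ?thesis
    using assms by (auto simp: digraph_iso_on_def intro: bij_betw_trans)
qed

lemma s_arc_map_iso:
  assumes "digraph_iso_on f D E" "s_arc D s p"
  shows "s_arc E s (map f p)"
proof -
  have "p ! i \<in> pverts D" if "i \<le> s" for i
    using assms(2) that by (auto simp: s_arc_def subset_iff)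
  then show ?thesis
    using assms digraph_iso_on_in_verts[OF assms(1)]
    by (auto simp: s_arc_def digraph_iso_on_def)
qed

lemma bij_betw_arcs_iso:
  assumes iso: "digraph_iso_on f D E" and wf: "pair_wf_digraph D" "pair_wf_digraph E"
    and v: "v \<in> pverts D"
  shows "bij_betw (map_prod f f) (in_arcs D v) (in_arcs E (f v))" (is ?in)
    and "bij_betw (map_prod f f) (out_arcs D v) (out_arcs E (f v))" (is ?out)
proof -
  have inj: "inj_on f (pverts D)" and img: "f ` pverts D = pverts E"
    and arc: "\<And>u w. u \<in> pverts D \<Longrightarrow> w \<in> pverts D \<Longrightarrow> (f u, f w) \<in> parcs E \<longleftrightarrow> (u, w) \<in> parcs D"
    using iso by (auto simp: digraph_iso_on_def bij_betw_def)
  have wfD: "u \<in> pverts D \<and> w \<in> pverts D" if "(u, w) \<in> parcs D" for u w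
    using wf(1) that by (metis pair_wf_digraph.in_arcsD1 pair_wf_digraph.in_arcsD2)
  have wfE: "u \<in> pverts E \<and> w \<in> pverts E" if "(u, w) \<in> parcs E" for u w
    using wf(2) that by (metis pair_wf_digraph.in_arcsD1 pair_wf_digraph.in_arcsD2)
  have inj2: "inj_on (map_prod f f) (parcs D)"
    using inj wfD by (fastforce simp: inj_on_def)
  have 1: "(u, v) \<in> parcs D \<Longrightarrow> (f u, f v) \<in> parcs E" for u v
    using arc wfD by blast
  have 2: "\<exists>u0 w0. u = f u0 \<and> w = f w0 \<and> (u0, w0) \<in> parcs D \<and> u0 \<in> pverts D \<and> w0 \<in> pverts D"
    if "(u, w) \<in> parcs E" for u w
    using wfE[OF that] img arc that by (metis imageE)
  have 3: "f w = f v \<Longrightarrow> w \<in> pverts D \<Longrightarrow> w = v" for w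
    using inj v by (auto simp: inj_on_def)
  have "map_prod f f ` in_arcs D v = in_arcs E (f v)"
  proof
    show "map_prod f f ` in_arcs D v \<subseteq> in_arcs E (f v)"
      using 1 by (auto simp: in_arcs_def)
    show "in_arcs E (f v) \<subseteq> map_prod f f ` in_arcs D v"
    proof
      fix e assume "e \<in> in_arcs E (f v)"
      then obtain u where e: "e = (u, f v)" "(u, f v) \<in> parcs E"
        by (cases e) (auto simp: in_arcs_def)
      obtain u0 w0 where "u = f u0" "f v = f w0" "(u0, w0) \<in> parcs D" "w0 \<in> pverts D"
        using 2[OF e(2)] by blast
      moreover from this have "w0 = v"
        using 3 by metis
      ultimately show "e \<in> map_prod f f ` in_arcs D v"
        using e by (auto simp: in_arcs_def image_iff)
    qed
  qed
  then show ?in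
    using inj2 by (auto simp: bij_betw_def in_arcs_def intro: inj_on_subset)
  have "map_prod f f ` out_arcs D v = out_arcs E (f v)"
  proof
    show "map_prod f f ` out_arcs D v \<subseteq> out_arcs E (f v)"
      using 1 by (auto simp: out_arcs_def)
    show "out_arcs E (f v) \<subseteq> map_prod f f ` out_arcs D v"
    proof
      fix e assume "e \<in> out_arcs E (f v)"
      then obtain u where e: "e = (f v, u)" "(f v, u) \<in> parcs E"
        by (cases e) (auto simp: out_arcs_def)
      obtain u0 w0 where "u = f u0" "f v = f w0" "(w0, u0) \<in> parcs D" "w0 \<in> pverts D"
        using 2[OF e(2)] by blast
      moreover from this have "w0 = v"
        using 3 by metis
      ultimately show "e \<in> map_prod f f ` out_arcs D v"
        using e by (auto simp: out_arcs_def image_iff)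
    qed
  qed
  then show ?out
    using inj2 by (auto simp: bij_betw_def out_arcs_def intro: inj_on_subset)
qed

lemma iso_degrees:
  assumes "digraph_iso_on f D E" "pair_wf_digraph D" "pair_wf_digraph E" "v \<in> pverts D"
  shows "in_degree E (f v) = in_degree D v" "out_degree E (f v) = out_degree D v"
  using bij_betw_same_card[OF bij_betw_arcs_iso(1)[OF assms]]
        bij_betw_same_card[OF bij_betw_arcs_iso(2)[OF assms]]
  by (simp_all add: in_degree_def out_degree_def)

section \<open>Criteria for high arc-transitivity and universal reachability\<close>

lemma ex_s_arc_from:
  assumes out: "\<And>v. v \<in> pverts D \<Longrightarrow> \<exists>w\<in>pverts D. (v, w) \<in> parcs D" and "v \<in> pverts D"
  shows "\<exists>p. s_arc D s p \<and> p ! 0 = v"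
  using assms(2)
proof (induction s arbitrary: v)
  case 0
  then show ?case
    by (intro exI[of _ "[v]"]) (simp add: s_arc_def)
next
  case (Suc s)
  obtain w where w: "w \<in> pverts D" "(v, w) \<in> parcs D"
    using out Suc.prems by blast
  obtain p where p: "s_arc D s p" "p ! 0 = w"
    using Suc.IH w by blast
  have "s_arc D (Suc s) (v # p)"
    using p w Suc.prems by (auto simp: s_arc_def nth_Cons split: nat.splits)
  then show ?case
    by (metis nth_Cons_0)
qed

text \<open>
  Since every \<open>s\<close>-arc can be moved so that it starts at \<open>r\<close>, only the \<open>s\<close>-arcs from \<open>r\<close> have to
  be compared. The criterion speaks of two isomorphic digraphs so that symmetry can be verified in a
  concrete model \<open>D\<close> and concluded for a copy \<open>E\<close> of it on another vertex type.
\<close>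
lemma highly_arc_transitiveI:
  assumes wf: "pair_wf_digraph E"
    and out: "\<And>v. v \<in> pverts E \<Longrightarrow> \<exists>w\<in>pverts E. (v, w) \<in> parcs E"
    and trans: "\<And>v. v \<in> pverts E \<Longrightarrow> \<exists>f. digraph_iso_on f E D \<and> f v = r"
    and rooted: "\<And>s p q. s_arc D s p \<Longrightarrow> s_arc D s q \<Longrightarrow> p ! 0 = r \<Longrightarrow> q ! 0 = r \<Longrightarrow>
                   \<exists>f. digraph_automorphism D f \<and> (\<forall>i\<le>s. f (p ! i) = q ! i)"
  shows "highly_arc_transitive E"
  unfolding highly_arc_transitive_def s_arc_transitive_def
proof (intro allI conjI impI)
  fix s
  show "no_isolated_vertices E"
    using out by (auto simp: no_isolated_vertices_def)
  show "\<forall>(u, v)\<in>parcs E. \<exists>p. s_arc E s p \<and> (\<exists>i<s. p ! i = u \<and> p ! (i + 1) = v)" if "1 \<le> s"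
  proof clarify
    fix u v assume uv: "(u, v) \<in> parcs E"
    then have verts: "u \<in> pverts E" "v \<in> pverts E"
      using wf by (metis pair_wf_digraph.in_arcsD1 pair_wf_digraph.in_arcsD2)+
    obtain p where p: "s_arc E (s - 1) p" "p ! 0 = v"
      using ex_s_arc_from[OF out verts(2)] by blast
    have "s_arc E s (u # p)"
      using p uv verts that by (auto simp: s_arc_def nth_Cons split: nat.splits)
    then show "\<exists>p. s_arc E s p \<and> (\<exists>i<s. p ! i = u \<and> p ! (i + 1) = v)"
      using p that by (intro exI[of _ "u # p"] conjI exI[of _ 0]) auto
  qed
  fix p q assume "s_arc E s p \<and> s_arc E s q"
  then have pq: "s_arc E s p" "s_arc E s q" by auto
  have in_verts: "p ! i \<in> pverts E" "q ! i \<in> pverts E" if "i \<le> s" for i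
    using pq that by (auto simp: s_arc_def subset_iff)
  have len: "length p = s + 1" "length q = s + 1"
    using pq by (auto simp: s_arc_def)
  obtain f where f: "digraph_iso_on f E D" "f (p ! 0) = r"
    using trans in_verts(1)[of 0] by auto
  obtain g where g: "digraph_iso_on g E D" "g (q ! 0) = r"
    using trans in_verts(2)[of 0] by auto
  obtain h where h: "digraph_iso_on h D D" "\<And>i. i \<le> s \<Longrightarrow> h (map f p ! i) = map g q ! i"
    using rooted[OF s_arc_map_iso[OF f(1) pq(1)] s_arc_map_iso[OF g(1) pq(2)]] f(2) g(2) len
    by (auto simp: digraph_automorphism_iff_iso)
  define k where "k = inv_into (pverts E) g \<circ> (h \<circ> f)"
  have "digraph_automorphism E k"
    unfolding k_def digraph_automorphism_iff_iso
    by (intro digraph_iso_on_comp[OF digraph_iso_on_comp[OF f(1) h(1)]] digraph_iso_on_inv g(1))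
  moreover have "k (p ! i) = q ! i" if "i \<le> s" for i
    using h(2)[OF that] len that digraph_iso_on_inv_apply[OF g(1) in_verts(2)[OF that]]
    by (simp add: k_def)
  ultimately show "\<exists>f. digraph_automorphism E f \<and> (\<forall>i\<le>s. f (p ! i) = q ! i)"
    by blast
qed

text \<open>
  Every arc of an alternating walk leaves exactly one of its two positions, hence the conditions on
  positions and the conditions on steps say the same. The latter are easier to extend at the end.
\<close>
lemma alternating_walk_iff_arcs:
  assumes "pair_wf_digraph D"
  shows "alternating_walk D b p \<longleftrightarrow>
    p \<noteq> [] \<and> set p \<subseteq> pverts D \<and> (\<forall>i. i + 1 < length p \<longrightarrow> walk_arc b p i \<in> parcs D)"
    (is "?L \<longleftrightarrow> ?R")
proof
  assume L: ?L
  have "walk_arc b p i \<in> parcs D" if i: "i + 1 < length p" for i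
  proof (cases "even i \<longleftrightarrow> b")
    case True
    then show ?thesis
      using L i by (auto simp: alternating_walk_def walk_arc_def)
  next
    case False
    then have "even (i + 1) \<longleftrightarrow> b" by auto
    then have "(p ! (i + 1), p ! (i + 1 - 1)) \<in> parcs D"
      using L i unfolding alternating_walk_def by (metis add_gr_0 less_one)
    then show ?thesis
      using False by (simp add: walk_arc_def)
  qed
  then show ?R
    using L by (auto simp: alternating_walk_def)
next
  assume R: ?R
  show ?L
    unfolding alternating_walk_def
  proof (intro conjI allI impI)
    fix i assume i: "i < length p" "even i \<longleftrightarrow> b"
    show "(p ! i, p ! (i + 1)) \<in> parcs D" if "i + 1 < length p"
      using R i that by (auto simp: walk_arc_def)
    show "(p ! i, p ! (i - 1)) \<in> parcs D" if "0 < i"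
    proof -
      have "walk_arc b p (i - 1) \<in> parcs D"
        using R i that by simp
      moreover have "\<not> (even (i - 1) \<longleftrightarrow> b)"
        using i(2) that by (cases i) auto
      ultimately show ?thesis
        using that by (simp add: walk_arc_def)
    qed
  qed (use R in auto)
qed

lemma reachability_subset_arcs:
  assumes "pair_wf_digraph D"
  shows "reachability_relation D \<subseteq> parcs D \<times> parcs D"
proof -
  have "walk_arc b p 0 \<in> parcs D \<and> walk_arc b p (length p - 2) \<in> parcs D"
    if "alternating_walk D b p" "2 \<le> length p" for b p
    using that by (simp add: alternating_walk_iff_arcs[OF assms])
  then show ?thesis
    unfolding reachability_relation_def by blast
qed

lemma reachability_refl:
  assumes "pair_wf_digraph D" "e \<in> parcs D"
  shows "(e, e) \<in> reachability_relation D"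
proof -
  have "alternating_walk D True [fst e, snd e]"
    using assms(2) pair_wf_digraph.arc_fst_in_verts[OF assms] pair_wf_digraph.arc_snd_in_verts[OF assms]
    by (auto simp: alternating_walk_iff_arcs[OF assms(1)] walk_arc_def)
  moreover have "walk_arc True [fst e, snd e] 0 = e"
    by (simp add: walk_arc_def)
  ultimately show ?thesis
    unfolding reachability_relation_def mem_Collect_eq case_prod_conv
    by (intro exI[of _ True] exI[of _ "[fst e, snd e]"]) simp
qed

lemma alternating_walk_snoc:
  assumes wf: "pair_wf_digraph D" and p: "alternating_walk D b p" "length p \<ge> 2"
    and z: "walk_arc b (p @ [z]) (length p - 1) \<in> parcs D"
  shows "alternating_walk D b (p @ [z])" "walk_arc b (p @ [z]) 0 = walk_arc b p 0"
proof -
  have same: "walk_arc b (p @ [z]) i = walk_arc b p i" if "i + 1 < length p" for i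
    using that by (simp add: walk_arc_def nth_append)
  have "z \<in> pverts D"
    using z p(2) pair_wf_digraph.arc_fst_in_verts[OF wf z] pair_wf_digraph.arc_snd_in_verts[OF wf z]
    by (auto simp: walk_arc_def split: if_splits)
  moreover have "walk_arc b (p @ [z]) i \<in> parcs D" if "i + 1 < length (p @ [z])" for i
  proof (cases "i + 1 < length p")
    case True
    then show ?thesis
      using same p(1) by (simp add: alternating_walk_iff_arcs[OF wf])
  next
    case False
    then have "i = length p - 1" using that by simp
    then show ?thesis using z by simp
  qed
  ultimately show "alternating_walk D b (p @ [z])"
    using p(1) by (auto simp: alternating_walk_iff_arcs[OF wf])
  show "walk_arc b (p @ [z]) 0 = walk_arc b p 0"
    using p(2) same by simp
qed

text \<open>
  A walk ending in the arc \<open>xy\<close> can be prolonged at its last vertex only, which is one of \<open>x\<close> and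
  \<open>y\<close>. To continue at the other one, the walk first traverses \<open>xy\<close> once more in the opposite
  direction.
\<close>
lemma reachability_step:
  assumes wf: "pair_wf_digraph D" and e: "(e, (x, y)) \<in> reachability_relation D"
  shows "(x, y') \<in> parcs D \<Longrightarrow> (e, (x, y')) \<in> reachability_relation D"
    and "(x', y) \<in> parcs D \<Longrightarrow> (e, (x', y)) \<in> reachability_relation D"
proof -
  obtain b p where p: "alternating_walk D b p" "length p \<ge> 2" "walk_arc b p 0 = e"
    "walk_arc b p (length p - 2) = (x, y)"
    using e unfolding reachability_relation_def by auto
  define n where "n = length p - 2"
  have n: "length p = n + 2" using p(2) n_def by simp
  have xy: "(x, y) \<in> parcs D"
    using reachability_subset_arcs[OF wf] e by auto
  have relI: "(e, e') \<in> reachability_relation D"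
    if "alternating_walk D b q" "length q \<ge> 2" "walk_arc b q 0 = e" "walk_arc b q (length q - 2) = e'" for q e'
    using that unfolding reachability_relation_def by blast
  have snoc: "alternating_walk D b (q @ [z]) \<and> walk_arc b (q @ [z]) 0 = e"
    if "alternating_walk D b q" "length q \<ge> 2" "walk_arc b q 0 = e"
      "walk_arc b (q @ [z]) (length q - 1) \<in> parcs D" for q z
    using alternating_walk_snoc[OF wf that(1,2,4)] that(3) by simp
  show "(e, (x, y')) \<in> reachability_relation D" if "(x, y') \<in> parcs D"
  proof (cases "even n \<longleftrightarrow> b")
    case True
    then have last: "p ! n = x" "p ! (n + 1) = y"
      using p(4) n by (auto simp: walk_arc_def)
    have 1: "walk_arc b (p @ [x]) (length p - 1) = (x, y)"
      using True last n by (auto simp: walk_arc_def nth_append)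
    have 2: "walk_arc b ((p @ [x]) @ [y']) (length (p @ [x]) - 1) = (x, y')"
      using True last n by (auto simp: walk_arc_def nth_append)
    have q: "alternating_walk D b (p @ [x]) \<and> walk_arc b (p @ [x]) 0 = e"
      using snoc[OF p(1-3)] 1 xy by simp
    have "alternating_walk D b ((p @ [x]) @ [y']) \<and> walk_arc b ((p @ [x]) @ [y']) 0 = e"
      using q 2 that p(2) by (intro snoc) auto
    then show ?thesis
      using 2 by (intro relI[of "(p @ [x]) @ [y']"]) auto
  next
    case False
    then have last: "p ! n = y" "p ! (n + 1) = x"
      using p(4) n by (auto simp: walk_arc_def)
    have 1: "walk_arc b (p @ [y']) (length p - 1) = (x, y')"
      using False last n by (auto simp: walk_arc_def nth_append)
    then have "alternating_walk D b (p @ [y']) \<and> walk_arc b (p @ [y']) 0 = e"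
      using snoc[OF p(1-3)] that by simp
    then show ?thesis
      using 1 n by (intro relI[of "p @ [y']"]) auto
  qed
  show "(e, (x', y)) \<in> reachability_relation D" if "(x', y) \<in> parcs D"
  proof (cases "even n \<longleftrightarrow> b")
    case True
    then have last: "p ! n = x" "p ! (n + 1) = y"
      using p(4) n by (auto simp: walk_arc_def)
    have 1: "walk_arc b (p @ [x']) (length p - 1) = (x', y)"
      using True last n by (auto simp: walk_arc_def nth_append)
    then have "alternating_walk D b (p @ [x']) \<and> walk_arc b (p @ [x']) 0 = e"
      using snoc[OF p(1-3)] that by simp
    then show ?thesis
      using 1 n by (intro relI[of "p @ [x']"]) auto
  next
    case False
    then have last: "p ! n = y" "p ! (n + 1) = x"
      using p(4) n by (auto simp: walk_arc_def)
    have 1: "walk_arc b (p @ [y]) (length p - 1) = (x, y)"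
      using False last n by (auto simp: walk_arc_def nth_append)
    have 2: "walk_arc b ((p @ [y]) @ [x']) (length (p @ [y]) - 1) = (x', y)"
      using False last n by (auto simp: walk_arc_def nth_append)
    have q: "alternating_walk D b (p @ [y]) \<and> walk_arc b (p @ [y]) 0 = e"
      using snoc[OF p(1-3)] 1 xy by simp
    have "alternating_walk D b ((p @ [y]) @ [x']) \<and> walk_arc b ((p @ [y]) @ [x']) 0 = e"
      using q 2 that p(2) by (intro snoc) auto
    then show ?thesis
      using 2 by (intro relI[of "(p @ [y]) @ [x']"]) auto
  qed
qed

definition common_out_neighbour :: "'a pair_pre_digraph \<Rightarrow> 'a \<Rightarrow> 'a \<Rightarrow> bool" where
  "common_out_neighbour D u v \<longleftrightarrow> (\<exists>w. (u, w) \<in> parcs D \<and> (v, w) \<in> parcs D)"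

lemma reachability_if_common_out_neighbours:
  assumes wf: "pair_wf_digraph D" and arcs: "(u, u') \<in> parcs D" "(v, v') \<in> parcs D"
    and "(common_out_neighbour D)\<^sup>*\<^sup>* u v"
  shows "((u, u'), (v, v')) \<in> reachability_relation D"
  using assms(4) arcs(2)
proof (induction arbitrary: v' rule: rtranclp_induct)
  case base
  then show ?case
    using reachability_step(1)[OF wf reachability_refl[OF wf arcs(1)]] by simp
next
  case (step w v)
  then obtain z where z: "(w, z) \<in> parcs D" "(v, z) \<in> parcs D"
    by (auto simp: common_out_neighbour_def)
  then have "((u, u'), (v, z)) \<in> reachability_relation D"
    using step.IH reachability_step(2)[OF wf] by blast
  then show ?case
    using reachability_step(1)[OF wf] step.prems by blast
qed

lemma universal_reachabilityI:
  assumes wf: "pair_wf_digraph D" and ne: "parcs D \<noteq> {}"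
    and conn: "\<And>u v. u \<in> pverts D \<Longrightarrow> v \<in> pverts D \<Longrightarrow> (common_out_neighbour D)\<^sup>*\<^sup>* u v"
  shows "universal_reachability D"
proof -
  have "(e, e') \<in> reachability_relation D" if "e \<in> parcs D" "e' \<in> parcs D" for e e'
    using reachability_if_common_out_neighbours[OF wf _ _ conn, of "fst e" "snd e" "fst e'" "snd e'"]
      that pair_wf_digraph.arc_fst_in_verts[OF wf] by simp
  then have "reachability_relation D `` {e} = parcs D" if "e \<in> parcs D" for e
    using that reachability_subset_arcs[OF wf] by blast
  then have "parcs D // reachability_relation D = {parcs D}"
    using ne by (auto simp: quotient_def)
  then show ?thesis
    by (simp add: universal_reachability_def)
qed

section \<open>The edges of a biregular tree\<close>

type_synonym letter = "bool \<times> nat"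

text \<open>
  Edges of a biregular tree are words over letters \<open>(t, c)\<close>. The Boolean \<open>t\<close> names one of the
  two classes of tree vertices. The empty word is a root edge, and \<open>(t, c) # w\<close> is the \<open>c\<close>-th
  further edge at the endpoint of \<open>w\<close> of class \<open>t\<close>, so that the head of a word is its outermost
  letter. Among the edges at the endpoint of \<open>w\<close> of class \<open>t\<close>, the one closest to the root edge is
  \<open>stem t w\<close>; thus \<open>stem t\<close> names this endpoint.
\<close>
fun stem :: "bool \<Rightarrow> letter list \<Rightarrow> letter list" where
  "stem t [] = []"
| "stem t (x # w) = (if fst x = t then w else x # w)"

definition meets :: "bool \<Rightarrow> letter list \<Rightarrow> letter list \<Rightarrow> bool" where
  "meets t u v \<longleftrightarrow> u \<noteq> v \<and> stem t u = stem t v"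

lemma meets_sym: "meets t u v \<longleftrightarrow> meets t v u"
  by (auto simp: meets_def)

text \<open>
  Vertices of class \<open>t\<close> have valency \<open>n t + 1\<close>: besides its stem, such a vertex has the edges
  numbered \<open>0, \<dots>, n t - 1\<close>.
\<close>
locale biregular_tree =
  fixes n :: "bool \<Rightarrow> nat"
  assumes branching: "2 \<le> n t"
begin

text \<open>
  Consecutive letters belong to different classes, for a word ending at some vertex can only be
  prolonged at the opposite endpoint of its outermost edge.
\<close>
primrec reduced :: "letter list \<Rightarrow> bool" where
  "reduced [] \<longleftrightarrow> True"
| "reduced (x # w) \<longleftrightarrow> snd x < n (fst x) \<and> (w = [] \<or> fst (hd w) \<noteq> fst x) \<and> reduced w"

lemma reduced_appendD: "reduced (u @ w) \<Longrightarrow> reduced u \<and> reduced w"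
  by (induction u) (auto simp: hd_append split: if_splits)

lemma reduced_stem: "reduced w \<Longrightarrow> reduced (stem t w)"
  by (cases w) auto

lemma stem_stem: "reduced w \<Longrightarrow> stem t (stem t w) = stem t w"
  by (cases w; cases "tl w") (auto split: if_splits)

lemma stem_tl_of_reduced: "reduced (x # w) \<Longrightarrow> stem (fst x) w = w"
  by (cases w) auto

text \<open>
  The hypothesis \<open>stem t u = u\<close> says that the endpoint of \<open>u\<close> of class \<open>t\<close> points away from the
  root edge; the other edges at it are the children of \<open>u\<close> there.
\<close>
lemma meets_fixed_stem:
  assumes "reduced v" "stem t u = u"
  shows "meets t u v \<longleftrightarrow> (\<exists>c. v = (t, c) # u)"
proof
  assume "meets t u v"
  then have "u \<noteq> v" "stem t v = u"
    using assms(2) by (auto simp: meets_def)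
  then show "\<exists>c. v = (t, c) # u"
    by (cases v) (auto split: if_splits)
next
  assume "\<exists>c. v = (t, c) # u"
  then show "meets t u v"
    using assms by (auto simp: meets_def)
qed

text \<open>
  Here valency at least three is used: the stem and the edges numbered 0 and 1 are three different
  edges at one vertex, and one of them differs from both \<open>u\<close> and \<open>v\<close>.
\<close>
lemma ex_third_edge:
  assumes "reduced u" "stem t u = stem t v"
  obtains w where "reduced w" "w \<noteq> u" "w \<noteq> v" "stem t w = stem t u"
proof -
  let ?s = "stem t u"
  have ss: "stem t ?s = ?s"
    using assms(1) by (rule stem_stem)
  have hd: "?s = [] \<or> fst (hd ?s) \<noteq> t"
    using ss by (cases ?s) (auto split: if_splits)
  have red: "reduced ?s" "reduced ((t, 0) # ?s)" "reduced ((t, 1) # ?s)"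
    using reduced_stem[OF assms(1)] hd branching[of t] by auto
  show thesis
  proof (cases "?s \<noteq> u \<and> ?s \<noteq> v")
    case True
    then show thesis using that[of ?s] red ss by simp
  next
    case False
    show thesis
    proof (cases "(t, 0) # ?s \<noteq> u \<and> (t, 0) # ?s \<noteq> v")
      case True
      then show thesis using that[of "(t, 0) # ?s"] red by simp
    next
      case b: False
      have "(t, 1) # ?s \<noteq> u \<and> (t, 1) # ?s \<noteq> v"
        using False b by (metis list.inject n_not_Suc_n not_Cons_self2 One_nat_def prod.inject)
      then show thesis using that[of "(t, 1) # ?s"] red by simp
    qed
  qed
qed

section \<open>The digraph of paths of length three\<close>

text \<open>The edge \<open>m\<close> is the middle one of the path; it leaves \<open>u\<close> at its endpoint of class \<open>True\<close>.\<close>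
definition edge_digraph :: "letter list pair_pre_digraph" where
  "edge_digraph = \<lparr> pverts = {w. reduced w},
     parcs = {(u, v). reduced u \<and> reduced v \<and>
                (\<exists>m. reduced m \<and> meets True u m \<and> meets False m v)} \<rparr>"

lemma edge_digraph_simps:
  "w \<in> pverts edge_digraph \<longleftrightarrow> reduced w"
  "(u, v) \<in> parcs edge_digraph \<longleftrightarrow>
     reduced u \<and> reduced v \<and> (\<exists>m. reduced m \<and> meets True u m \<and> meets False m v)"
  by (auto simp: edge_digraph_def)

lemma wf_edge_digraph: "pair_wf_digraph edge_digraph"
  by unfold_locales (auto simp: edge_digraph_def)

lemma out_neighbour_iff:
  assumes "stem True u = u" "reduced u"
  shows "(u, v) \<in> parcs edge_digraph \<longleftrightarrow>
           (\<exists>c d. c < n True \<and> d < n False \<and> v = (False, d) # (True, c) # u)" (is "_ \<longleftrightarrow> ?R")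
proof
  assume "(u, v) \<in> parcs edge_digraph"
  then obtain m where m: "reduced v" "reduced m" "meets True u m" "meets False m v"
    by (auto simp: edge_digraph_simps)
  then obtain c where c: "m = (True, c) # u"
    using assms meets_fixed_stem by blast
  then obtain d where "v = (False, d) # m"
    using m meets_fixed_stem[of v False m] by auto
  then show ?R
    using c m by auto
next
  assume ?R
  then obtain c d where cd: "c < n True" "d < n False" "v = (False, d) # (True, c) # u"
    by blast
  have "u = [] \<or> fst (hd u) \<noteq> True"
    using assms(1) by (cases u) auto
  then have "reduced ((True, c) # u)" "reduced v"
    using cd assms(2) by auto
  moreover have "meets True u ((True, c) # u)" "meets False ((True, c) # u) v"
    using cd assms(1) by (auto simp: meets_def)
  ultimately show "(u, v) \<in> parcs edge_digraph"
    unfolding edge_digraph_simps using assms(2) by blast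
qed

lemma in_neighbour_root_iff:
  "(u, []) \<in> parcs edge_digraph \<longleftrightarrow>
     (\<exists>c d. c < n True \<and> d < n False \<and> u = [(True, c), (False, d)])" (is "_ \<longleftrightarrow> ?R")
proof
  assume "(u, []) \<in> parcs edge_digraph"
  then obtain m where m: "reduced u" "reduced m" "meets True m u" "meets False [] m"
    by (auto simp: edge_digraph_simps meets_sym)
  then obtain d where d: "m = [(False, d)]"
    using meets_fixed_stem[of m False "[]"] by auto
  then obtain c where "u = (True, c) # m"
    using m meets_fixed_stem[of u True m] by auto
  then show ?R
    using d m by auto
next
  assume ?R
  then obtain c d where cd: "c < n True" "d < n False" "u = [(True, c), (False, d)]"
    by blast
  then have "reduced u" "reduced [(False, d)]" "meets True u [(False, d)]" "meets False [(False, d)] []"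
    by (auto simp: meets_def)
  then show "(u, []) \<in> parcs edge_digraph"
    unfolding edge_digraph_simps using reduced.simps(1) by blast
qed

lemma degrees_root:
  "out_degree edge_digraph [] = n True * n False"
  "in_degree edge_digraph [] = n True * n False"
proof -
  let ?C = "{..<n True} \<times> {..<n False}"
  let ?out = "\<lambda>(c, d). ([] :: letter list, [(False, d), (True, c)])"
  let ?in = "\<lambda>(c, d). ([(True, c), (False, d)], [] :: letter list)"
  have "out_arcs edge_digraph [] = ?out ` ?C"
    by (auto simp: out_arcs_def out_neighbour_iff image_iff)
  moreover have "inj_on ?out ?C"
    by (auto simp: inj_on_def)
  ultimately show "out_degree edge_digraph [] = n True * n False"
    by (simp add: out_degree_def card_image card_cartesian_product)
  have "in_arcs edge_digraph [] = ?in ` ?C"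
    by (auto simp: in_arcs_def in_neighbour_root_iff image_iff)
  moreover have "inj_on ?in ?C"
    by (auto simp: inj_on_def)
  ultimately show "in_degree edge_digraph [] = n True * n False"
    by (simp add: in_degree_def card_image card_cartesian_product)
qed

section \<open>Universal reachability\<close>

lemma common_out_neighbour_if_meets_True:
  assumes "reduced u" "reduced v" "stem True u = stem True v"
  shows "common_out_neighbour edge_digraph u v"
proof -
  obtain m where m: "reduced m" "m \<noteq> u" "m \<noteq> v" "stem True m = stem True u"
    using ex_third_edge[OF assms(1,3)] .
  obtain w where w: "reduced w" "w \<noteq> m" "stem False w = stem False m"
    using ex_third_edge[OF m(1) refl] .
  have "(u, w) \<in> parcs edge_digraph" "(v, w) \<in> parcs edge_digraph"
    unfolding edge_digraph_simps meets_def using assms m w by metis+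
  then show ?thesis
    by (auto simp: common_out_neighbour_def)
qed

text \<open>
  With \<open>w\<close> a third edge at the common endpoint of \<open>u\<close> and \<open>v\<close>, neither \<open>u\<close> nor \<open>v\<close> has an arc
  to \<open>w\<close>, but edges \<open>u'\<close> and \<open>v'\<close> adjacent to \<open>u\<close> and \<open>v\<close> at their opposite endpoints do.
\<close>
lemma connected_if_meets_False:
  assumes "reduced u" "reduced v" "stem False u = stem False v"
  shows "(common_out_neighbour edge_digraph)\<^sup>*\<^sup>* u v"
proof -
  obtain w where w: "reduced w" "w \<noteq> u" "w \<noteq> v" "stem False w = stem False u"
    using ex_third_edge[OF assms(1,3)] .
  obtain u' where u': "reduced u'" "u' \<noteq> u" "stem True u' = stem True u"
    using ex_third_edge[OF assms(1) refl] .
  obtain v' where v': "reduced v'" "v' \<noteq> v" "stem True v' = stem True v"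
    using ex_third_edge[OF assms(2) refl] .
  have "(u', w) \<in> parcs edge_digraph" "(v', w) \<in> parcs edge_digraph"
    unfolding edge_digraph_simps meets_def using assms w u' v' by metis+
  then have "common_out_neighbour edge_digraph u' v'"
    by (auto simp: common_out_neighbour_def)
  moreover have "common_out_neighbour edge_digraph u u'" "common_out_neighbour edge_digraph v' v"
    using common_out_neighbour_if_meets_True assms u' v' by simp_all
  ultimately show ?thesis
    by (meson converse_rtranclp_into_rtranclp rtranclp.rtrancl_refl)
qed

lemma connected_to_root:
  "reduced w \<Longrightarrow> (common_out_neighbour edge_digraph)\<^sup>*\<^sup>* w []"
proof (induction w)
  case (Cons x w)
  then have "stem (fst x) (x # w) = stem (fst x) w"
    using stem_tl_of_reduced[of x w] by simp
  then have "(common_out_neighbour edge_digraph)\<^sup>*\<^sup>* (x # w) w"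
    using Cons.prems common_out_neighbour_if_meets_True[of "x # w" w] connected_if_meets_False[of "x # w" w]
    by (cases "fst x") auto
  then show ?case
    using Cons by (auto intro: rtranclp_trans)
qed simp

lemma connected_edge_digraph:
  assumes "reduced u" "reduced v"
  shows "(common_out_neighbour edge_digraph)\<^sup>*\<^sup>* u v"
proof -
  have "symp (common_out_neighbour edge_digraph)"
    by (auto simp: symp_def common_out_neighbour_def)
  then have "(common_out_neighbour edge_digraph)\<^sup>*\<^sup>* [] v"
    using connected_to_root[OF assms(2)] by (metis symp_rtranclp sympD)
  then show ?thesis
    using connected_to_root[OF assms(1)] by (rule rtranclp_trans[rotated])
qed

section \<open>Automorphisms\<close>

text \<open>
  A map of edges comes from an automorphism of the tree that preserves both classes of vertices if
  edges sharing an endpoint of class \<open>t\<close> are mapped to edges sharing an endpoint of class \<open>t\<close>. As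
  \<open>x # w\<close> meets \<open>w\<close> in class \<open>fst x\<close>, and this adjacency generates all others, it is enough to
  ask this for a word and its tail. For involutions the converse implication is automatic.
\<close>
definition tree_involution :: "(letter list \<Rightarrow> letter list) \<Rightarrow> bool" where
  "tree_involution \<phi> \<longleftrightarrow>
     (\<forall>w. reduced w \<longrightarrow> reduced (\<phi> w) \<and> \<phi> (\<phi> w) = w) \<and>
     (\<forall>x w. reduced (x # w) \<longrightarrow> stem (fst x) (\<phi> (x # w)) = stem (fst x) (\<phi> w))"

lemma tree_involution_automorphism:
  assumes \<phi>: "tree_involution \<phi>"
  shows "digraph_automorphism edge_digraph \<phi>"
proof -
  have red: "reduced (\<phi> w)" and inv: "\<phi> (\<phi> w) = w" if "reduced w" for w
    using \<phi> that by (auto simp: tree_involution_def)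
  have stem: "stem t (\<phi> w) = stem t (\<phi> (stem t w))" if "reduced w" for t w
    using \<phi> that by (cases w) (auto simp: tree_involution_def)
  have meets: "meets t (\<phi> u) (\<phi> v)" if "meets t u v" "reduced u" "reduced v" for t u v
    using that stem inv unfolding meets_def by metis
  have arc: "(\<phi> u, \<phi> v) \<in> parcs edge_digraph" if "(u, v) \<in> parcs edge_digraph" for u v
    using that meets red by (fastforce simp: edge_digraph_simps)
  have "bij_betw \<phi> (pverts edge_digraph) (pverts edge_digraph)"
    using red inv by (intro bij_betwI[of _ _ _ \<phi>]) (auto simp: edge_digraph_simps(1))
  moreover have "(\<phi> u, \<phi> v) \<in> parcs edge_digraph \<longleftrightarrow> (u, v) \<in> parcs edge_digraph"
    if "u \<in> pverts edge_digraph" "v \<in> pverts edge_digraph" for u v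
    using arc[of u v] arc[of "\<phi> u" "\<phi> v"] inv that by (auto simp: edge_digraph_simps(1))
  ultimately show ?thesis
    by (simp add: digraph_automorphism_def)
qed

text \<open>
  This exchanges the root edge \<open>[]\<close> with the edge \<open>[x]\<close> next to it, together with the branches
  at the endpoints that the two edges do not share, and fixes everything beyond the other edges at
  the shared endpoint. As words grow at the head, the change takes place at their far end.
\<close>
fun swap_root :: "letter \<Rightarrow> letter list \<Rightarrow> letter list" where
  "swap_root x [] = [x]"
| "swap_root x (y # w) =
     (if w = [] \<and> fst y = fst x then (if y = x then [] else [y]) else y # swap_root x w)"

lemma swap_root_snoc: "swap_root x (w @ [x]) = w"
  by (induction w) auto

lemma hd_swap_root:
  "w \<noteq> [] \<Longrightarrow> swap_root x w \<noteq> [] \<Longrightarrow> hd (swap_root x w) = hd w"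
  by (cases w) auto

lemma tree_involution_swap_root:
  assumes x: "snd x < n (fst x)"
  shows "tree_involution (swap_root x)"
proof -
  have red: "reduced (swap_root x w) \<and> swap_root x (swap_root x w) = w" if "reduced w" for w
    using that
  proof (induction w)
    case (Cons y w)
    show ?case
    proof (cases "w = []")
      case True
      then show ?thesis using Cons.prems x by auto
    next
      case False
      have "swap_root x w \<noteq> [] \<or> w = [x]"
        using False by (cases w) (auto split: if_splits)
      then show ?thesis
        using Cons hd_swap_root[OF False, of x] False x by (auto split: if_splits)
    qed
  qed (use x in auto)
  moreover have "stem (fst y) (swap_root x (y # w)) = stem (fst y) (swap_root x w)"
    if "reduced (y # w)" for y w
  proof (cases "w = []")
    case False
    have "stem (fst y) (swap_root x w) = swap_root x w"
      using hd_swap_root[OF False, of x] that False by (cases "swap_root x w") auto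
    then show ?thesis using False by simp
  qed auto
  ultimately show ?thesis
    by (simp add: tree_involution_def)
qed

lemma ex_automorphism_to_root:
  "reduced w \<Longrightarrow> \<exists>f. digraph_automorphism edge_digraph f \<and> f w = []"
proof (induction w rule: rev_induct)
  case Nil
  show ?case
    by (intro exI[of _ id]) (simp add: digraph_automorphism_def bij_betw_id[unfolded id_def])
next
  case (snoc x w)
  then have "reduced w" "snd x < n (fst x)"
    using reduced_appendD[of w "[x]"] by auto
  then obtain f where f: "digraph_automorphism edge_digraph f" "f w = []"
    using snoc.IH by blast
  have "digraph_automorphism edge_digraph (f \<circ> swap_root x)"
    using f(1) tree_involution_automorphism[OF tree_involution_swap_root[OF \<open>snd x < n (fst x)\<close>]]
    unfolding digraph_automorphism_iff_iso by (rule digraph_iso_on_comp[rotated])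
  then show ?case
    using f(2) swap_root_snoc by (metis comp_apply)
qed

text \<open>
  Words are read from the root edge outwards, so the letter \<open>x\<close> of \<open>x # w\<close> stands at position
  \<open>length w\<close>. At every position \<open>i\<close> the letters \<open>cs ! i\<close> and \<open>ds ! i\<close> are exchanged, whatever
  the preceding letters are; in this way prefixes of \<open>cs\<close> become prefixes of \<open>ds\<close>.
\<close>
primrec twist :: "letter list \<Rightarrow> letter list \<Rightarrow> letter list \<Rightarrow> letter list" where
  "twist cs ds [] = []"
| "twist cs ds (x # w) =
     (if length w < length cs
      then Transposition.transpose (cs ! length w) (ds ! length w) x else x) # twist cs ds w"

lemma length_twist [simp]: "length (twist cs ds w) = length w"
  by (induction w) auto

lemma twist_rev_take:
  assumes "length cs = length ds" "i \<le> length cs"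
  shows "twist cs ds (rev (take i cs)) = rev (take i ds)"
  using assms(2)
  by (induction i) (auto simp: take_Suc_conv_app_nth assms(1))

lemma tree_involution_twist:
  assumes len: "length cs = length ds"
    and type: "\<And>i. i < length cs \<Longrightarrow> fst (cs ! i) = fst (ds ! i)"
    and valid: "\<And>i. i < length cs \<Longrightarrow> snd (cs ! i) < n (fst (cs ! i)) \<and> snd (ds ! i) < n (fst (ds ! i))"
  shows "tree_involution (twist cs ds)"
proof -
  have fst_tr: "fst (Transposition.transpose (cs ! i) (ds ! i) x) = fst x" if "i < length cs" for i x
    using type[OF that] by (auto simp: Transposition.transpose_def)
  have valid_tr: "snd (Transposition.transpose (cs ! i) (ds ! i) x) < n (fst x)"
    if "i < length cs" "snd x < n (fst x)" for i x
    using type[OF that(1)] valid[OF that(1)] that(2) by (auto simp: Transposition.transpose_def)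
  have hd: "fst (hd (twist cs ds w)) = fst (hd w)" if "w \<noteq> []" for w
    using that fst_tr by (cases w) auto
  have nil: "twist cs ds w = [] \<longleftrightarrow> w = []" for w
    by (cases w) auto
  have red: "reduced (twist cs ds w) \<and> twist cs ds (twist cs ds w) = w" if "reduced w" for w
    using that hd by (induction w) (auto simp: fst_tr valid_tr nil)
  moreover have "stem (fst x) (twist cs ds (x # w)) = stem (fst x) (twist cs ds w)"
    if "reduced (x # w)" for x w
  proof -
    have "stem (fst x) (twist cs ds w) = twist cs ds w"
      using that hd[of w] nil[of w] by (cases "twist cs ds w") auto
    then show ?thesis
      using fst_tr by simp
  qed
  ultimately show ?thesis
    by (simp add: tree_involution_def)
qed

text \<open>
  An arc from the root edge moves away from it, first through class \<open>True\<close> and then through class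
  \<open>False\<close>. From there on the endpoint of class \<open>True\<close> points away from the root edge, so every
  further arc appends two more letters. The members of the \<open>s\<close>-arc are therefore the initial
  segments of even length of one sequence \<open>cs\<close>, read from the root edge; as vertices they appear
  reversed.
\<close>
lemma s_arc_from_root:
  assumes "s_arc edge_digraph s p" "p ! 0 = []"
  shows "\<exists>cs. length cs = 2 * s \<and>
     (\<forall>j<2 * s. fst (cs ! j) = even j \<and> snd (cs ! j) < n (fst (cs ! j))) \<and>
     (\<forall>i\<le>s. p ! i = rev (take (2 * i) cs))"
  using assms
proof (induction s arbitrary: p)
  case (Suc s)
  have p: "length p = s + 2" "\<And>i. i \<le> s \<Longrightarrow> (p ! i, p ! (i + 1)) \<in> parcs edge_digraph"
    using Suc.prems by (auto simp: s_arc_def)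
  have "s_arc edge_digraph s (butlast p)" "butlast p ! 0 = []"
    using Suc.prems p in_set_butlastD[of _ p] by (auto simp: s_arc_def nth_butlast)
  then obtain cs where cs: "length cs = 2 * s"
     "\<forall>j<2 * s. fst (cs ! j) = even j \<and> snd (cs ! j) < n (fst (cs ! j))"
     "\<forall>i\<le>s. butlast p ! i = rev (take (2 * i) cs)"
    using Suc.IH by blast
  then have pi: "p ! i = rev (take (2 * i) cs)" if "i \<le> s" for i
    using p(1) that cs(3) nth_butlast[of i p] by simp
  have "stem True (rev cs) = rev cs"
  proof (cases s)
    case (Suc r)
    then have "rev cs = cs ! (2 * s - 1) # rev (butlast cs)"
      using cs(1) by (cases cs rule: rev_cases) (auto simp: nth_append)
    moreover have "\<not> fst (cs ! (2 * s - 1))"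
      using cs(2) Suc by auto
    ultimately show ?thesis
      by (metis stem.simps(2))
  qed (use cs in simp)
  moreover have "(rev cs, p ! (s + 1)) \<in> parcs edge_digraph"
    using p(2)[of s] pi[of s] cs(1) by simp
  moreover have "reduced (rev cs)"
    using calculation(2) by (simp add: edge_digraph_simps)
  ultimately obtain c d where cd: "c < n True" "d < n False"
    "p ! (s + 1) = (False, d) # (True, c) # rev cs"
    using out_neighbour_iff by blast
  let ?cs = "cs @ [(True, c), (False, d)]"
  have "length ?cs = 2 * Suc s"
    using cs(1) by simp
  moreover have "fst (?cs ! j) = even j \<and> snd (?cs ! j) < n (fst (?cs ! j))" if "j < 2 * Suc s" for j
  proof -
    have "j < 2 * s \<or> j = 2 * s \<or> j = 2 * s + 1"
      using that by auto
    then show ?thesis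
      using cs(1,2) cd by (elim disjE) (auto simp: nth_append)
  qed
  moreover have "p ! i = rev (take (2 * i) ?cs)" if "i \<le> Suc s" for i
    using pi[of i] cd(3) cs(1) that by (cases "i = Suc s") auto
  ultimately show ?case
    by blast
qed simp

lemma ex_automorphism_rooted_s_arcs:
  assumes p: "s_arc edge_digraph s p" "p ! 0 = []" and q: "s_arc edge_digraph s q" "q ! 0 = []"
  shows "\<exists>f. digraph_automorphism edge_digraph f \<and> (\<forall>i\<le>s. f (p ! i) = q ! i)"
proof -
  obtain cs where cs: "length cs = 2 * s"
     "\<forall>j<2 * s. fst (cs ! j) = even j \<and> snd (cs ! j) < n (fst (cs ! j))"
     "\<forall>i\<le>s. p ! i = rev (take (2 * i) cs)"
    using s_arc_from_root[OF p] by blast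
  obtain ds where ds: "length ds = 2 * s"
     "\<forall>j<2 * s. fst (ds ! j) = even j \<and> snd (ds ! j) < n (fst (ds ! j))"
     "\<forall>i\<le>s. q ! i = rev (take (2 * i) ds)"
    using s_arc_from_root[OF q] by blast
  have "tree_involution (twist cs ds)"
    using cs(1,2) ds(1,2) by (intro tree_involution_twist) auto
  moreover have "twist cs ds (p ! i) = q ! i" if "i \<le> s" for i
    using that cs ds by (simp add: twist_rev_take)
  ultimately show ?thesis
    using tree_involution_automorphism by blast
qed

section \<open>A copy on the natural numbers\<close>

definition nat_digraph :: "nat pair_pre_digraph" where
  "nat_digraph = \<lparr> pverts = to_nat ` pverts edge_digraph,
                   parcs = map_prod to_nat to_nat ` parcs edge_digraph \<rparr>"

lemma to_nat_iso: "digraph_iso_on to_nat edge_digraph nat_digraph"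
  by (auto simp: digraph_iso_on_def nat_digraph_def bij_betw_def inj_on_def)

lemma wf_nat_digraph: "pair_wf_digraph nat_digraph"
  by unfold_locales (auto simp: nat_digraph_def edge_digraph_def)

lemma ex_iso_to_root:
  assumes "v \<in> pverts nat_digraph"
  shows "\<exists>f. digraph_iso_on f nat_digraph edge_digraph \<and> f v = []"
proof -
  obtain w where w: "w \<in> pverts edge_digraph" "v = to_nat w"
    using assms by (auto simp: nat_digraph_def)
  obtain f where f: "digraph_iso_on f edge_digraph edge_digraph" "f w = []"
    using ex_automorphism_to_root w(1)
    by (auto simp: digraph_automorphism_iff_iso edge_digraph_simps)
  let ?g = "inv_into (pverts edge_digraph) to_nat"
  have "digraph_iso_on (f \<circ> ?g) nat_digraph edge_digraph"
    by (intro digraph_iso_on_comp[OF _ f(1)] digraph_iso_on_inv to_nat_iso)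
  moreover have "(f \<circ> ?g) v = []"
    using f(2) w digraph_iso_on_inv_apply[OF to_nat_iso] by simp
  ultimately show ?thesis by blast
qed

lemma degrees_nat_digraph:
  assumes "v \<in> pverts nat_digraph"
  shows "in_degree nat_digraph v = n True * n False" "out_degree nat_digraph v = n True * n False"
proof -
  obtain f where "digraph_iso_on f nat_digraph edge_digraph" "f v = []"
    using ex_iso_to_root[OF assms] by blast
  then show "in_degree nat_digraph v = n True * n False" "out_degree nat_digraph v = n True * n False"
    using iso_degrees[OF _ wf_nat_digraph wf_edge_digraph assms] degrees_root by metis+
qed

lemma positive_degree: "0 < n True * n False"
  using branching[of True] branching[of False] by simp

lemma locally_finite_nat_digraph: "locally_finite_digraph nat_digraph"
  unfolding locally_finite_digraph_def
  using degrees_nat_digraph positive_degree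
  by (metis card_ge_0_finite in_degree_def out_degree_def)

lemma loopfree_nat_digraph: "pair_loopfree_digraph nat_digraph"
proof -
  have "u \<noteq> v" if uv: "(u, v) \<in> parcs nat_digraph" for u v
  proof
    assume "u = v"
    have v: "v \<in> pverts nat_digraph"
      using wf_nat_digraph uv by (rule pair_wf_digraph.in_arcsD2)
    then obtain f where "digraph_iso_on f nat_digraph edge_digraph" "f v = []"
      using ex_iso_to_root by blast
    then have "([], []) \<in> parcs edge_digraph"
      using uv v \<open>u = v\<close> by (metis digraph_iso_on_def)
    then show False
      by (simp add: in_neighbour_root_iff)
  qed
  then show ?thesis
    using wf_nat_digraph by (auto simp: pair_loopfree_digraph_def pair_loopfree_digraph_axioms_def)
qed

lemma highly_arc_transitive_nat_digraph: "highly_arc_transitive nat_digraph"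
proof (rule highly_arc_transitiveI[OF wf_nat_digraph _ ex_iso_to_root ex_automorphism_rooted_s_arcs])
  fix v assume v: "v \<in> pverts nat_digraph"
  have "out_arcs nat_digraph v \<noteq> {}"
    using degrees_nat_digraph(2)[OF v] positive_degree by (auto simp: out_degree_def)
  then show "\<exists>w\<in>pverts nat_digraph. (v, w) \<in> parcs nat_digraph"
    using pair_wf_digraph.in_arcsD2[OF wf_nat_digraph] by (auto simp: out_arcs_def)
qed

lemma universal_reachability_nat_digraph: "universal_reachability nat_digraph"
proof (rule universal_reachabilityI[OF wf_nat_digraph])
  have "([], [(False, 0), (True, 0)]) \<in> parcs edge_digraph"
    using branching[of True] branching[of False] by (simp add: out_neighbour_iff)
  then show "parcs nat_digraph \<noteq> {}"
    by (auto simp: nat_digraph_def)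
  have common: "common_out_neighbour nat_digraph (to_nat u) (to_nat v)"
    if "common_out_neighbour edge_digraph u v" for u v
    using that by (force simp: common_out_neighbour_def nat_digraph_def)
  have "(common_out_neighbour nat_digraph)\<^sup>*\<^sup>* (to_nat u) (to_nat v)"
    if "(common_out_neighbour edge_digraph)\<^sup>*\<^sup>* u v" for u v
    using that
  proof induction
    case (step v w)
    then show ?case
      using common by (metis rtranclp.rtrancl_into_rtrancl)
  qed simp
  then show "(common_out_neighbour nat_digraph)\<^sup>*\<^sup>* u v"
    if "u \<in> pverts nat_digraph" "v \<in> pverts nat_digraph" for u v
    using that connected_edge_digraph by (auto simp: nat_digraph_def edge_digraph_simps)
qed

end

lemma composite_factors:
  fixes d :: nat
  assumes "2 \<le> d" "\<not> prime d"
  obtains a b where "2 \<le> a" "2 \<le> b" "d = a * b"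
proof -
  obtain a where a: "a dvd d" "a \<noteq> 1" "a \<noteq> d"
    using assms by (auto simp: prime_nat_iff)
  then obtain b where "d = a * b" by blast
  moreover have "2 \<le> a" "2 \<le> b"
    using a assms(1) calculation by (auto simp: numeral_2_eq_2 Suc_le_eq intro: Suc_lessI intro!: gr0I)
  ultimately show thesis using that by blast
qed

lemma ex_digraph_of_composite_degree:
  assumes "4 \<le> d" "\<not> prime d"
  shows "\<exists>D :: nat pair_pre_digraph.
     pair_loopfree_digraph D \<and> locally_finite_digraph D \<and>
     highly_arc_transitive D \<and> universal_reachability D \<and>
     (\<forall>v\<in>pverts D. in_degree D v = d \<and> out_degree D v = d)"
proof -
  obtain a b where ab: "2 \<le> a" "2 \<le> b" "d = a * b"
    using composite_factors[of d] assms by auto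
  interpret biregular_tree "\<lambda>t. if t then a else b"
    by unfold_locales (use ab in auto)
  show ?thesis
    using loopfree_nat_digraph locally_finite_nat_digraph highly_arc_transitive_nat_digraph
      universal_reachability_nat_digraph degrees_nat_digraph ab(3)
    by (intro exI[of _ nat_digraph]) auto
qed

theorem theorem2p1:
  shows "(\<exists>D :: nat pair_pre_digraph.
            pair_loopfree_digraph D \<and> locally_finite_digraph D \<and>
            highly_arc_transitive D \<and> universal_reachability D) \<and>
         (\<forall>d::nat. d \<ge> 4 \<and> \<not> prime d \<longrightarrow>
            (\<exists>D :: nat pair_pre_digraph.
               pair_loopfree_digraph D \<and> locally_finite_digraph D \<and>
               highly_arc_transitive D \<and> universal_reachability D \<and>
               (\<forall>v\<in>pverts D. in_degree D v = d \<and> out_degree D v = d)))"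
proof
  have "\<not> prime (4 :: nat)"
    by (auto simp: prime_nat_iff intro!: exI[of _ 2])
  then show "\<exists>D :: nat pair_pre_digraph.
      pair_loopfree_digraph D \<and> locally_finite_digraph D \<and>
      highly_arc_transitive D \<and> universal_reachability D"
    using ex_digraph_of_composite_degree[of 4] by auto
qed (use ex_digraph_of_composite_degree in blast)

end
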